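(* Let $\Omega,\Sigma,\lambda_\Omega,\lambda_\Sigma,D,D^\tau,\mathcal D_0,\mathcal E_\alpha,C_\alpha$ be as in the context, and let $C_\Omega, C_\Sigma<\infty$ be upper bounds for the Poincaré constants at $\alpha=1$ and $\alpha=0$, i.e. for all $f\in\mathcal D_0$ $$\mathrm{Var}_{\lambda_\Omega}f\le C_\Omega\int_\Omega\|Df\|^2d\lambda_\Omega,\qquad \mathrm{Var}_{\lambda_\Sigma}f\le C_\Sigma\int_\Sigma\|D^\tau f\|^2d\lambda_\Sigma .$$ Assume there exist constants $K_{\Sigma,\Omega},K_1,K_2$ such that for any $f\in\mathcal D_0$ $$\mathrm{Var}_{\lambda_\Sigma}f\le K_{\Sigma,\Omega}\int_\Omega\|Df\|^2d\lambda_\Omega$$ and $$\left(\int_\Omega f\,d\lambda_\Omega-\int_\Sigma f\,d\lambda_\Sigma\right)^2\le K_1\int_\Omega\|Df\|^2d\lambda_\Omega+K_2\int_\Sigma\|D^\tau f\|^2d\lambda_\Sigma .$$ Then for any $\alpha\in(0,1)$, $$C_\alpha\le\max\left\{C_\Omega+(1-\alpha)K_1,\ \alpha K_2,\ \frac{(1-\alpha)K_{\Sigma,\Omega}C_\Sigma+\alpha C_\Omega C_\Sigma+\alpha(1-\alpha)(K_{\Sigma,\Omega}K_2+C_\Sigma K_1)}{(1-\alpha)K_{\Sigma,\Omega}+\alpha C_\Sigma}\right\}.$$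
   Context: $\Omega$ is an open domain in $\mathbb R^d$ or a Riemannian manifold, with piecewise smooth boundary $\partial\Omega$; $\Sigma$ is a smooth compact connected subset of $\partial\Omega$ (possibly $\Sigma=\partial\Omega$). $\lambda_\Omega$ and $\lambda_\Sigma$ are probability measures with supports $\Omega$ (i.e. its closure) and $\Sigma$, absolutely continuous with respect to the Lebesgue (volume) measure on $\Omega$ and the Hausdorff (surface) measure on $\Sigma$, respectively. $D:C^1(\Omega)\to\Gamma^0(\Omega)$ and $D^\tau:C^1(\partial\Omega)\to\Gamma^0(\partial\Omega)$ are given first-order gradient operators (linear first-order differential operators without zeroth-order term) mapping differentiable functions to continuous (tangential) vector fields on $\Omega$, resp. $\partial\Omega$. For $\alpha\in[0,1]$, $$\lambda_\alpha=\alpha\lambda_\Omega+(1-\alpha)\lambda_\Sigma,\qquad \mathcal E_\alpha(f)=\alpha\int_\Omega\|Df\|^2d\lambda_\Omega+(1-\alpha)\int_\Sigma\|D^\tau f\|^2d\lambda_\Sigma,\quad f\in\mathcal D_0,$$ where $\mathcal D_0\subset C^1(\overline\Omega)$ is dense in $C(\overline\Omega)$, and it is assumed that for each $\alpha\in[0,1]$ the form $(\mathcal E_\alpha,\mathcal D_0)$ is a pre-Dirichlet form on $L^2(\overline\Omega,\lambda_\alpha)$ (closable, with closure a Dirichlet form). $\mathrm{Var}_\mu f=\int f^2d\mu-(\int f\,d\mu)^2$. The optimal Poincaré constant is $$C_\alpha=\sup\left\{\frac{\mathrm{Var}_{\lambda_\alpha}f}{\mathcal E_\alpha(f)}:\ f\in\mathcal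 D_0,\ \mathcal E_\alpha(f)>0\right\}.$$ *)

theory Defs
  imports "HOL-Analysis.Analysis"
begin

section \<open>Smooth and Riemannian manifolds\<close>

text \<open>A manifold of dimension \<open>CARD('n)\<close> is a whole Hausdorff, second countable type \<open>'m\<close> with a
  (not necessarily maximal) smooth atlas. A chart is its domain together with the coordinate map;
  the values of the map outside the domain are irrelevant.\<close>

type_synonym ('m, 'n) chart = "'m set \<times> ('m \<Rightarrow> real ^ 'n)"

abbreviation chart_dom :: "('m, 'n::finite) chart \<Rightarrow> 'm set" where
  "chart_dom c \<equiv> fst c"

abbreviation coord :: "('m, 'n::finite) chart \<Rightarrow> 'm \<Rightarrow> real ^ 'n" where
  "coord c \<equiv> snd c"

definition coord_inv :: "('m, 'n::finite) chart \<Rightarrow> real ^ 'n \<Rightarrow> 'm" where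
  "coord_inv c = inv_into (chart_dom c) (coord c)"

text \<open>This is class \<open>C^k\<close> only for open \<open>U\<close> in finite-dimensional spaces.\<close>

primrec Ck_on :: "nat \<Rightarrow> 'a::real_normed_vector set \<Rightarrow> ('a \<Rightarrow> 'b::real_normed_vector) \<Rightarrow> bool" where
  "Ck_on 0 U f \<longleftrightarrow> continuous_on U f"
| "Ck_on (Suc k) U f \<longleftrightarrow> (\<forall>x\<in>U. f differentiable (at x)) \<and>
     (\<forall>v. Ck_on k U (\<lambda>x. frechet_derivative f (at x) v))"

definition smooth_atlas ::
  "('m::{t2_space, second_countable_topology}, 'n::finite) chart set \<Rightarrow> bool" where
  "smooth_atlas \<A> \<longleftrightarrow>
     (\<forall>c\<in>\<A>. open (chart_dom c) \<and> open (coord c ` chart_dom c) \<and>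
        homeomorphism (chart_dom c) (coord c ` chart_dom c) (coord c) (coord_inv c)) \<and>
     (\<Union>c\<in>\<A>. chart_dom c) = UNIV \<and>
     (\<forall>c\<in>\<A>. \<forall>c'\<in>\<A>. \<forall>k. Ck_on k (coord c ` (chart_dom c \<inter> chart_dom c')) (coord c' \<circ> coord_inv c))"

definition transition_deriv ::
  "('m, 'n::finite) chart \<Rightarrow> ('m, 'n) chart \<Rightarrow> 'm \<Rightarrow> real ^ 'n \<Rightarrow> real ^ 'n" where
  "transition_deriv c c' p = frechet_derivative (coord c' \<circ> coord_inv c) (at (coord c p))"

text \<open>The metric tensor is given by its Gram matrices \<open>G c p = (g_ij(p))\<close> in the charts \<open>c\<close>.\<close>

definition riemannian_manifold ::
  "('m::{t2_space, second_countable_topology}, 'n::finite) chart set \<Rightarrow>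
   (('m, 'n) chart \<Rightarrow> 'm \<Rightarrow> real ^ 'n ^ 'n) \<Rightarrow> bool" where
  "riemannian_manifold \<A> G \<longleftrightarrow> smooth_atlas \<A> \<and>
     (\<forall>c\<in>\<A>. \<forall>p\<in>chart_dom c. transpose (G c p) = G c p \<and> (\<forall>v. v \<noteq> 0 \<longrightarrow> v \<bullet> (G c p *v v) > 0)) \<and>
     (\<forall>c\<in>\<A>. \<forall>k. Ck_on k (coord c ` chart_dom c) (\<lambda>x. G c (coord_inv c x))) \<and>
     (\<forall>c\<in>\<A>. \<forall>c'\<in>\<A>. \<forall>p\<in>chart_dom c \<inter> chart_dom c'. \<forall>v w.
        v \<bullet> (G c p *v w) = transition_deriv c c' p v \<bullet> (G c' p *v transition_deriv c c' p w))"

subsection \<open>Differentiable functions and maps\<close>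

text \<open>Class \<open>C^k\<close> for real functions on an open subset \<open>U\<close> of the manifold, and for maps from an
  open subset \<open>W\<close> of a normed space into the manifold.\<close>

definition Ck_fun ::
  "('m, 'n::finite) chart set \<Rightarrow> nat \<Rightarrow> 'm set \<Rightarrow> ('m \<Rightarrow> real) \<Rightarrow> bool" where
  "Ck_fun \<A> k U F \<longleftrightarrow> (\<forall>c\<in>\<A>. Ck_on k (coord c ` (chart_dom c \<inter> U)) (F \<circ> coord_inv c))"

definition Ck_map ::
  "('m::topological_space, 'n::finite) chart set \<Rightarrow> nat \<Rightarrow> 'a::real_normed_vector set \<Rightarrow> ('a \<Rightarrow> 'm) \<Rightarrow> bool" where
  "Ck_map \<A> k W \<gamma> \<longleftrightarrow> continuous_on W \<gamma> \<and>
     (\<forall>c\<in>\<A>. Ck_on k (W \<inter> \<gamma> -` chart_dom c) (coord c \<circ> \<gamma>))"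

text \<open>\<open>C1 \<A> S\<close> is the space \<open>C^1(S)\<close> for an arbitrary subset \<open>S\<close>: near every point of \<open>S\<close> the function
  is the restriction to \<open>S\<close> of a \<open>C^1\<close> function of the ambient manifold. For open \<open>S\<close> these are the
  usual \<open>C^1\<close> functions; the definition is also used for the closure and the boundary of a domain.
  Values outside \<open>S\<close> are irrelevant.\<close>

definition local_extension ::
  "('m::topological_space, 'n::finite) chart set \<Rightarrow> 'm set \<Rightarrow> ('m \<Rightarrow> real) \<Rightarrow> 'm \<Rightarrow> ('m \<Rightarrow> real) \<Rightarrow> bool" where
  "local_extension \<A> S f p F \<longleftrightarrow>
     (\<exists>U. open U \<and> p \<in> U \<and> Ck_fun \<A> 1 U F \<and> (\<forall>q\<in>S \<inter> U. F q = f q))"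

definition C1 :: "('m::topological_space, 'n::finite) chart set \<Rightarrow> 'm set \<Rightarrow> ('m \<Rightarrow> real) set" where
  "C1 \<A> S = {f. \<forall>p\<in>S. \<exists>F. local_extension \<A> S f p F}"

definition partials :: "('m, 'n::finite) chart \<Rightarrow> ('m \<Rightarrow> real) \<Rightarrow> 'm \<Rightarrow> real ^ 'n" where
  "partials c F p = (\<chi> i. frechet_derivative (F \<circ> coord_inv c) (at (coord c p)) (axis i 1))"

subsection \<open>Vector fields and gradient operators\<close>

text \<open>A vector field is represented by its components \<open>X c p\<close> in all charts \<open>c\<close> around \<open>p\<close>.\<close>

type_synonym ('m, 'n) vector_field = "('m, 'n) chart \<Rightarrow> 'm \<Rightarrow> real ^ 'n"

definition vector_field_on :: "('m, 'n::finite) chart set \<Rightarrow> 'm set \<Rightarrow> ('m, 'n) vector_field \<Rightarrow> bool" where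
  "vector_field_on \<A> S X \<longleftrightarrow> (\<forall>c\<in>\<A>. \<forall>c'\<in>\<A>. \<forall>p\<in>S \<inter> chart_dom c \<inter> chart_dom c'.
     X c' p = transition_deriv c c' p (X c p))"

definition chart_at :: "('m, 'n::finite) chart set \<Rightarrow> 'm \<Rightarrow> ('m, 'n) chart" where
  "chart_at \<A> p = (SOME c. c \<in> \<A> \<and> p \<in> chart_dom c)"

text \<open>The Riemannian inner product of two vector fields at \<open>p\<close>; it does not depend on the chart.\<close>

definition metric_inner ::
  "('m, 'n::finite) chart set \<Rightarrow> (('m, 'n) chart \<Rightarrow> 'm \<Rightarrow> real ^ 'n ^ 'n) \<Rightarrow>
   ('m, 'n) vector_field \<Rightarrow> ('m, 'n) vector_field \<Rightarrow> 'm \<Rightarrow> real" where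
  "metric_inner \<A> G X Y p = (let c = chart_at \<A> p in X c p \<bullet> (G c p *v Y c p))"

text \<open>The tangent space (in the chart \<open>c\<close>) of an arbitrary set \<open>S\<close> at \<open>p\<close>: the vectors annihilated by
  all \<open>C^1\<close> functions that vanish on \<open>S\<close> near \<open>p\<close>. It is everything if \<open>S\<close> is open, and the usual tangent
  space wherever \<open>S\<close> is a hypersurface. The differential of \<open>f \<in> C^1(S)\<close> is well defined exactly
  on this space.\<close>

definition tangent_space ::
  "('m::topological_space, 'n::finite) chart set \<Rightarrow> 'm set \<Rightarrow> ('m, 'n) chart \<Rightarrow> 'm \<Rightarrow> (real ^ 'n) set" where
  "tangent_space \<A> S c p = {v. \<forall>F. local_extension \<A> S (\<lambda>_. 0) p F \<longrightarrow> partials c F p \<bullet> v = 0}"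

text \<open>\<open>smooth_part \<A> S\<close>: the points near which \<open>S\<close> is a smooth hypersurface without boundary.\<close>

definition smooth_part :: "('m::topological_space, 'n::finite) chart set \<Rightarrow> 'm set \<Rightarrow> 'm set" where
  "smooth_part \<A> S = {p\<in>S. \<exists>U h. open U \<and> p \<in> U \<and> (\<forall>k. Ck_fun \<A> k U h) \<and>
     (\<forall>c\<in>\<A>. p \<in> chart_dom c \<longrightarrow> partials c h p \<noteq> 0) \<and> S \<inter> U = {q\<in>U. h q = 0}}"

text \<open>A gradient operator \<open>C^1(S) \<rightarrow> \<Gamma>^0(S)\<close>: a linear first-order differential operator
  without zeroth-order term, \<open>(D f)^i(p) = \<Sum>_j a_ij(p) \<partial>_j F(p)\<close> for every local
  \<open>C^1\<close> extension \<open>F\<close> of \<open>f\<close>, whose values are vector fields tangential to \<open>S\<close>. Linearity in \<open>f\<close>, and the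
  dependence on \<open>f\<close> through its restriction to \<open>S\<close> only, follow from this representation.
  Continuity of \<open>D f\<close> is required on the subset \<open>R\<close>: all of \<open>S\<close> for a domain, the smooth part for
  a piecewise smooth boundary (a field that is tangential to each of two faces cannot in
  general be continuous across their common edge).\<close>

definition gradient_operator ::
  "('m::topological_space, 'n::finite) chart set \<Rightarrow> 'm set \<Rightarrow> 'm set \<Rightarrow>
   (('m \<Rightarrow> real) \<Rightarrow> ('m, 'n) vector_field) \<Rightarrow> bool" where
  "gradient_operator \<A> S R D \<longleftrightarrow>
     (\<forall>f\<in>C1 \<A> S. vector_field_on \<A> S (D f) \<and>
        (\<forall>c\<in>\<A>. (\<forall>p\<in>S \<inter> chart_dom c. D f c p \<in> tangent_space \<A> S c p) \<and>
                continuous_on (R \<inter> chart_dom c) (D f c))) \<and>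
     (\<forall>c\<in>\<A>. \<forall>p\<in>S \<inter> chart_dom c. \<exists>a :: real ^ 'n ^ 'n.
        \<forall>f\<in>C1 \<A> S. \<forall>F. local_extension \<A> S f p F \<longrightarrow> D f c p = a *v partials c F p)"

abbreviation gradient_operator_domain ::
  "('m::topological_space, 'n::finite) chart set \<Rightarrow> 'm set \<Rightarrow>
   (('m \<Rightarrow> real) \<Rightarrow> ('m, 'n) vector_field) \<Rightarrow> bool" where
  "gradient_operator_domain \<A> \<Omega> D \<equiv> gradient_operator \<A> \<Omega> \<Omega> D"

abbreviation gradient_operator_boundary ::
  "('m::topological_space, 'n::finite) chart set \<Rightarrow> 'm set \<Rightarrow>
   (('m \<Rightarrow> real) \<Rightarrow> ('m, 'n) vector_field) \<Rightarrow> bool" where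
  "gradient_operator_boundary \<A> \<Omega> D \<equiv>
     gradient_operator \<A> (frontier \<Omega>) (smooth_part \<A> (frontier \<Omega>)) D"

subsection \<open>Hypersurfaces and piecewise smooth boundaries\<close>

text \<open>A smooth embedded hypersurface, possibly with boundary: at a boundary point \<open>p\<close> it is
  locally \<open>{h = 0, k \<ge> 0}\<close> with \<open>dh\<close>, \<open>dk\<close> linearly independent at \<open>p\<close> and \<open>k p = 0\<close>.\<close>

definition smooth_hypersurface :: "('m::topological_space, 'n::finite) chart set \<Rightarrow> 'm set \<Rightarrow> bool" where
  "smooth_hypersurface \<A> S \<longleftrightarrow> (\<forall>p\<in>S. p \<in> smooth_part \<A> S \<or>
     (\<exists>U h k. open U \<and> p \<in> U \<and> (\<forall>j. Ck_fun \<A> j U h \<and> Ck_fun \<A> j U k) \<and> k p = 0 \<and>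
        (\<forall>c\<in>\<A>. p \<in> chart_dom c \<longrightarrow> (\<forall>a b. a *\<^sub>R partials c h p + b *\<^sub>R partials c k p = 0 \<longrightarrow> a = 0 \<and> b = 0)) \<and>
        S \<inter> U = {q\<in>U. h q = 0 \<and> k q \<ge> 0}))"

text \<open>A smooth patch is the image of a closed unit cube of dimension \<open>CARD('n) - 1\<close> (the face
  \<open>x_i = 0\<close> of the unit cube of \<open>\<real>^n\<close>) under a map that is smooth in a neighbourhood of
  the cube and an injective immersion on its relative interior. A set is piecewise smooth if
  it is a locally finite union of such patches.\<close>

definition smooth_patch :: "('m::topological_space, 'n::finite) chart set \<Rightarrow> 'm set \<Rightarrow> bool" where
  "smooth_patch \<A> P \<longleftrightarrow> (\<exists>(i::'n) W \<gamma>.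
     let Q = {x :: real ^ 'n. x $ i = 0 \<and> (\<forall>j. j \<noteq> i \<longrightarrow> 0 \<le> x $ j \<and> x $ j \<le> 1)};
         Q' = {x :: real ^ 'n. x $ i = 0 \<and> (\<forall>j. j \<noteq> i \<longrightarrow> 0 < x $ j \<and> x $ j < 1)}
     in open W \<and> Q \<subseteq> W \<and> (\<forall>k. Ck_map \<A> k W \<gamma>) \<and> P = \<gamma> ` Q \<and> inj_on \<gamma> Q' \<and>
        (\<forall>x\<in>Q'. \<forall>v. v $ i = 0 \<and> v \<noteq> 0 \<longrightarrow>
           (\<forall>c\<in>\<A>. \<gamma> x \<in> chart_dom c \<longrightarrow> frechet_derivative (coord c \<circ> \<gamma>) (at x) v \<noteq> 0)))"

definition piecewise_smooth :: "('m::topological_space, 'n::finite) chart set \<Rightarrow> 'm set \<Rightarrow> bool" where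
  "piecewise_smooth \<A> S \<longleftrightarrow> (\<exists>\<P>. S = \<Union>\<P> \<and> (\<forall>P\<in>\<P>. smooth_patch \<A> P) \<and>
     (\<forall>p. \<exists>U. open U \<and> p \<in> U \<and> finite {P\<in>\<P>. P \<inter> U \<noteq> {}}))"

section \<open>Volume and Hausdorff measure\<close>

text \<open>This determines the Riemannian volume measure uniquely.\<close>

definition riemannian_volume ::
  "('m::topological_space, 'n::finite) chart set \<Rightarrow> (('m, 'n) chart \<Rightarrow> 'm \<Rightarrow> real ^ 'n ^ 'n) \<Rightarrow> 'm measure \<Rightarrow> bool" where
  "riemannian_volume \<A> G vol \<longleftrightarrow> sets vol = sets borel \<and>
     (\<forall>c\<in>\<A>. \<forall>B\<in>sets borel. B \<subseteq> chart_dom c \<longrightarrow>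
        emeasure vol B = (\<integral>\<^sup>+x\<in>coord c ` B. ennreal (sqrt (det (G c (coord_inv c x)))) \<partial>lborel))"

text \<open>The Riemannian distance, \<open>\<infinity>\<close> for points that cannot be joined. The curves are \<open>C^1\<close> near \<open>[0,1]\<close>;
  they may stop, so corners are allowed and piecewise \<open>C^1\<close> curves give the same infimum.\<close>

definition curve_length ::
  "('m, 'n::finite) chart set \<Rightarrow> (('m, 'n) chart \<Rightarrow> 'm \<Rightarrow> real ^ 'n ^ 'n) \<Rightarrow> (real \<Rightarrow> 'm) \<Rightarrow> ennreal" where
  "curve_length \<A> G \<gamma> = (\<integral>\<^sup>+t\<in>{0..1}.
     (let c = chart_at \<A> (\<gamma> t); v = vector_derivative (coord c \<circ> \<gamma>) (at t)
      in ennreal (sqrt (v \<bullet> (G c (\<gamma> t) *v v)))) \<partial>lborel)"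

definition riemannian_dist ::
  "('m::topological_space, 'n::finite) chart set \<Rightarrow> (('m, 'n) chart \<Rightarrow> 'm \<Rightarrow> real ^ 'n ^ 'n) \<Rightarrow> 'm \<Rightarrow> 'm \<Rightarrow> ennreal" where
  "riemannian_dist \<A> G p q =
     (INF \<gamma>\<in>{\<gamma>. (\<exists>T. open T \<and> {0..1} \<subseteq> T \<and> Ck_map \<A> 1 T \<gamma>) \<and> \<gamma> 0 = p \<and> \<gamma> 1 = q}. curve_length \<A> G \<gamma>)"

definition riemannian_diam ::
  "('m::topological_space, 'n::finite) chart set \<Rightarrow> (('m, 'n) chart \<Rightarrow> 'm \<Rightarrow> real ^ 'n ^ 'n) \<Rightarrow> 'm set \<Rightarrow> ennreal" where
  "riemannian_diam \<A> G B = (SUP p\<in>B. SUP q\<in>B. riemannian_dist \<A> G p q)"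

text \<open>The \<open>s\<close>-dimensional Hausdorff measure, as an outer measure on all subsets. Note that
  \<open>0 ^ 0 = 1\<close>, so empty covering sets have to be treated separately when \<open>s = 0\<close>.\<close>

definition hausdorff_measure ::
  "('m::topological_space, 'n::finite) chart set \<Rightarrow> (('m, 'n) chart \<Rightarrow> 'm \<Rightarrow> real ^ 'n ^ 'n) \<Rightarrow> nat \<Rightarrow> 'm set \<Rightarrow> ennreal" where
  "hausdorff_measure \<A> G s A =
     (SUP \<delta>\<in>{0<..}. INF B\<in>{B :: nat \<Rightarrow> 'm set. A \<subseteq> (\<Union>i. B i) \<and> (\<forall>i. riemannian_diam \<A> G (B i) \<le> \<delta>)}.
        (\<Sum>i. if B i = {} then 0
             else ennreal (unit_ball_vol (real s) / 2 ^ s) * riemannian_diam \<A> G (B i) ^ s))"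

section \<open>Measures on closed sets\<close>

text \<open>Measures on a closed set \<open>K\<close> are measures whose space is \<open>K\<close>, with the Borel sets of \<open>K\<close>.\<close>

definition borel_prob_on :: "'m::topological_space set \<Rightarrow> 'm measure \<Rightarrow> bool" where
  "borel_prob_on K \<mu> \<longleftrightarrow> sets \<mu> = sets (restrict_space borel K) \<and> emeasure \<mu> (space \<mu>) = 1"

definition measure_support :: "'m::topological_space measure \<Rightarrow> 'm set" where
  "measure_support \<mu> = {p\<in>space \<mu>. \<forall>U. open U \<and> p \<in> U \<longrightarrow> emeasure \<mu> (U \<inter> space \<mu>) > 0}"

definition mixture :: "real \<Rightarrow> 'a measure \<Rightarrow> 'a measure \<Rightarrow> 'a measure" where
  "mixture \<alpha> \<mu> \<nu> = measure_of (space \<mu>) (sets \<mu>)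
     (\<lambda>A. ennreal \<alpha> * emeasure \<mu> A + ennreal (1 - \<alpha>) * emeasure \<nu> A)"

definition Var :: "'a measure \<Rightarrow> ('a \<Rightarrow> real) \<Rightarrow> real" where
  "Var \<mu> f = (\<integral>x. (f x)\<^sup>2 \<partial>\<mu>) - (\<integral>x. f x \<partial>\<mu>)\<^sup>2"

text \<open>Density in \<open>C(K)\<close> with respect to uniform convergence on compact sets, that is, uniform
  convergence if \<open>K\<close> is compact.\<close>

definition dense_in_C :: "'m::topological_space set \<Rightarrow> ('m \<Rightarrow> real) set \<Rightarrow> bool" where
  "dense_in_C K \<D> \<longleftrightarrow> (\<forall>h L \<epsilon>. continuous_on K h \<and> compact L \<and> L \<subseteq> K \<and> \<epsilon> > 0 \<longrightarrow>
     (\<exists>f\<in>\<D>. \<forall>p\<in>L. \<bar>f p - h p\<bar> < \<epsilon>))"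

section \<open>Dirichlet forms\<close>

text \<open>Forms on \<open>L^2(\<mu>)\<close> are given on sets of square integrable representatives.\<close>

definition L2 :: "'a measure \<Rightarrow> ('a \<Rightarrow> real) set" where
  "L2 \<mu> = {f \<in> borel_measurable \<mu>. integrable \<mu> (\<lambda>x. (f x)\<^sup>2)}"

definition L2_tendsto :: "'a measure \<Rightarrow> (nat \<Rightarrow> 'a \<Rightarrow> real) \<Rightarrow> ('a \<Rightarrow> real) \<Rightarrow> bool" where
  "L2_tendsto \<mu> u f \<longleftrightarrow> (\<forall>n. u n \<in> L2 \<mu>) \<and> f \<in> L2 \<mu> \<and> (\<lambda>n. \<integral>x. (u n x - f x)\<^sup>2 \<partial>\<mu>) \<longlonglongrightarrow> 0"

definition symmetric_form ::
  "'a measure \<Rightarrow> ('a \<Rightarrow> real) set \<Rightarrow> (('a \<Rightarrow> real) \<Rightarrow> ('a \<Rightarrow> real) \<Rightarrow> real) \<Rightarrow> bool" where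
  "symmetric_form \<mu> \<D> E \<longleftrightarrow>
     \<D> \<subseteq> L2 \<mu> \<and> (\<lambda>_. 0) \<in> \<D> \<and>
     (\<forall>f\<in>\<D>. \<forall>g\<in>\<D>. (\<lambda>x. f x + g x) \<in> \<D>) \<and> (\<forall>f\<in>\<D>. \<forall>a. (\<lambda>x. a * f x) \<in> \<D>) \<and>
     (\<forall>f\<in>L2 \<mu>. \<exists>u. (\<forall>n. u n \<in> \<D>) \<and> L2_tendsto \<mu> u f) \<and>
     (\<forall>f\<in>\<D>. \<forall>g\<in>\<D>. E f g = E g f) \<and>
     (\<forall>f\<in>\<D>. \<forall>g\<in>\<D>. \<forall>h\<in>\<D>. E (\<lambda>x. f x + g x) h = E f h + E g h) \<and>
     (\<forall>f\<in>\<D>. \<forall>g\<in>\<D>. \<forall>a. E (\<lambda>x. a * f x) g = a * E f g) \<and>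
     (\<forall>f\<in>\<D>. E f f \<ge> 0)"

definition form_Cauchy ::
  "('a \<Rightarrow> real) set \<Rightarrow> (('a \<Rightarrow> real) \<Rightarrow> ('a \<Rightarrow> real) \<Rightarrow> real) \<Rightarrow> (nat \<Rightarrow> 'a \<Rightarrow> real) \<Rightarrow> bool" where
  "form_Cauchy \<D> E u \<longleftrightarrow> (\<forall>n. u n \<in> \<D>) \<and>
     (\<forall>\<epsilon>>0. \<exists>N. \<forall>m\<ge>N. \<forall>n\<ge>N. E (\<lambda>x. u m x - u n x) (\<lambda>x. u m x - u n x) < \<epsilon>)"

definition closable_form ::
  "'a measure \<Rightarrow> ('a \<Rightarrow> real) set \<Rightarrow> (('a \<Rightarrow> real) \<Rightarrow> ('a \<Rightarrow> real) \<Rightarrow> real) \<Rightarrow> bool" where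
  "closable_form \<mu> \<D> E \<longleftrightarrow> (\<forall>u. form_Cauchy \<D> E u \<and> L2_tendsto \<mu> u (\<lambda>_. 0) \<longrightarrow>
     (\<lambda>n. E (u n) (u n)) \<longlonglongrightarrow> 0)"

definition closure_domain ::
  "'a measure \<Rightarrow> ('a \<Rightarrow> real) set \<Rightarrow> (('a \<Rightarrow> real) \<Rightarrow> ('a \<Rightarrow> real) \<Rightarrow> real) \<Rightarrow> ('a \<Rightarrow> real) set" where
  "closure_domain \<mu> \<D> E = {f. \<exists>u. form_Cauchy \<D> E u \<and> L2_tendsto \<mu> u f}"

text \<open>For a closable form the limit exists and does not depend on the approximating sequences.\<close>

definition closure_form ::
  "'a measure \<Rightarrow> ('a \<Rightarrow> real) set \<Rightarrow> (('a \<Rightarrow> real) \<Rightarrow> ('a \<Rightarrow> real) \<Rightarrow> real) \<Rightarrow> ('a \<Rightarrow> real) \<Rightarrow> ('a \<Rightarrow> real) \<Rightarrow> real" where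
  "closure_form \<mu> \<D> E f g = (THE l. \<forall>u v.
     form_Cauchy \<D> E u \<and> L2_tendsto \<mu> u f \<and> form_Cauchy \<D> E v \<and> L2_tendsto \<mu> v g \<longrightarrow>
     (\<lambda>n. E (u n) (v n)) \<longlonglongrightarrow> l)"

text \<open>The second condition is closedness (completeness in the form norm), the third is the Markov
  property for the unit contraction.\<close>

definition dirichlet_form ::
  "'a measure \<Rightarrow> ('a \<Rightarrow> real) set \<Rightarrow> (('a \<Rightarrow> real) \<Rightarrow> ('a \<Rightarrow> real) \<Rightarrow> real) \<Rightarrow> bool" where
  "dirichlet_form \<mu> \<D> E \<longleftrightarrow> symmetric_form \<mu> \<D> E \<and>
     (\<forall>u f. form_Cauchy \<D> E u \<and> L2_tendsto \<mu> u f \<longrightarrow>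
        f \<in> \<D> \<and> (\<lambda>n. E (\<lambda>x. u n x - f x) (\<lambda>x. u n x - f x)) \<longlonglongrightarrow> 0) \<and>
     (\<forall>f\<in>\<D>. (\<lambda>x. min (max (f x) 0) 1) \<in> \<D> \<and>
        E (\<lambda>x. min (max (f x) 0) 1) (\<lambda>x. min (max (f x) 0) 1) \<le> E f f)"

definition pre_dirichlet_form ::
  "'a measure \<Rightarrow> ('a \<Rightarrow> real) set \<Rightarrow> (('a \<Rightarrow> real) \<Rightarrow> ('a \<Rightarrow> real) \<Rightarrow> real) \<Rightarrow> bool" where
  "pre_dirichlet_form \<mu> \<D> E \<longleftrightarrow> symmetric_form \<mu> \<D> E \<and> closable_form \<mu> \<D> E \<and>
     dirichlet_form \<mu> (closure_domain \<mu> \<D> E) (closure_form \<mu> \<D> E)"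

text \<open>Extended-real valued, because the supremum may be \<open>\<infinity>\<close>.\<close>

definition poincare_constant ::
  "'a measure \<Rightarrow> ('a \<Rightarrow> real) set \<Rightarrow> (('a \<Rightarrow> real) \<Rightarrow> ('a \<Rightarrow> real) \<Rightarrow> real) \<Rightarrow> ereal" where
  "poincare_constant \<mu> \<D> E = (SUP f\<in>{f\<in>\<D>. E f f > 0}. ereal (Var \<mu> f / E f f))"

subsection \<open>The energy forms\<close>

text \<open>The forms are polarized: the diagonal of \<open>dirichlet_integral\<close> is the integral over \<open>S\<close> of
  \<open>\<parallel>D f\<parallel>^2\<close>, and \<open>\<E>_\<alpha>(f) = energy ... \<alpha> f f\<close>. The integral of a
  non-integrable function is \<open>0\<close>; \<open>finite_energy\<close> is the requirement that the energy of every
  \<open>f \<in> \<D>\<close> is a real number.\<close>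

definition dirichlet_integral ::
  "('m, 'n::finite) chart set \<Rightarrow> (('m, 'n) chart \<Rightarrow> 'm \<Rightarrow> real ^ 'n ^ 'n) \<Rightarrow> 'm set \<Rightarrow> 'm measure \<Rightarrow>
   (('m \<Rightarrow> real) \<Rightarrow> ('m, 'n) vector_field) \<Rightarrow> ('m \<Rightarrow> real) \<Rightarrow> ('m \<Rightarrow> real) \<Rightarrow> real" where
  "dirichlet_integral \<A> G S \<mu> D f g = (LINT p:S|\<mu>. metric_inner \<A> G (D f) (D g) p)"

definition finite_energy ::
  "('m, 'n::finite) chart set \<Rightarrow> (('m, 'n) chart \<Rightarrow> 'm \<Rightarrow> real ^ 'n ^ 'n) \<Rightarrow> 'm set \<Rightarrow> 'm measure \<Rightarrow>
   (('m \<Rightarrow> real) \<Rightarrow> ('m, 'n) vector_field) \<Rightarrow> ('m \<Rightarrow> real) set \<Rightarrow> bool" where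
  "finite_energy \<A> G S \<mu> D \<D> \<longleftrightarrow> (\<forall>f\<in>\<D>. set_integrable \<mu> S (metric_inner \<A> G (D f) (D f)))"

definition energy ::
  "('m, 'n::finite) chart set \<Rightarrow> (('m, 'n) chart \<Rightarrow> 'm \<Rightarrow> real ^ 'n ^ 'n) \<Rightarrow>
   'm set \<Rightarrow> 'm measure \<Rightarrow> (('m \<Rightarrow> real) \<Rightarrow> ('m, 'n) vector_field) \<Rightarrow>
   'm set \<Rightarrow> 'm measure \<Rightarrow> (('m \<Rightarrow> real) \<Rightarrow> ('m, 'n) vector_field) \<Rightarrow>
   real \<Rightarrow> ('m \<Rightarrow> real) \<Rightarrow> ('m \<Rightarrow> real) \<Rightarrow> real" where
  "energy \<A> G \<Omega> \<mu> D \<Sigma> \<nu> D\<tau> \<alpha> f g =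
     \<alpha> * dirichlet_integral \<A> G \<Omega> \<mu> D f g + (1 - \<alpha>) * dirichlet_integral \<A> G \<Sigma> \<nu> D\<tau> f g"

section \<open>Euclidean space as a Riemannian manifold\<close>

text \<open>Domains in \<open>\<real>^n\<close> are the special case of the single chart \<open>id\<close> and the constant metric;
  the volume is Lebesgue measure.\<close>

lemma coord_inv_id: "coord_inv (UNIV, \<lambda>x. x) = (\<lambda>x. x)"
  by (simp add: coord_inv_def fun_eq_iff inv_into_f_f)

lemma Ck_on_const: "Ck_on k U (\<lambda>x. c)"
  by (induction k arbitrary: c) auto

lemma Ck_on_id: "Ck_on k U (\<lambda>x. x)"
  by (cases k) (auto simp: frechet_derivative_ident Ck_on_const)

lemma riemannian_manifold_euclidean:
  "riemannian_manifold {(UNIV, \<lambda>x::real^'n::finite. x)} (\<lambda>c p. mat 1)"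
  by (auto simp: riemannian_manifold_def smooth_atlas_def coord_inv_id comp_def transition_deriv_def
      Ck_on_const Ck_on_id frechet_derivative_ident homeomorphism_def transpose_mat)

lemma riemannian_volume_euclidean:
  "riemannian_volume {(UNIV, \<lambda>x::real^'n::finite. x)} (\<lambda>c p. mat 1) lborel"
  by (simp add: riemannian_volume_def)

end

theory Submission
  imports Defs "HOL-Probability.Probability_Measure"
begin

text \<open>The law of total variance (\<open>Var_mixture\<close>) splits the variance of the
  mixture into \<alpha> times the interior variance, 1 - \<alpha> times the variance v on
  \<open>\<Sigma>\<close>, and \<alpha> (1 - \<alpha>) times the squared difference of the means.
  Let a and b be the interior and the boundary energy. The first and the last term are together at
  most \<alpha> p a + (1 - \<alpha>) q b, where p =
  \<open>C\<^sub>\<Omega> + (1 - \<alpha>) * K\<^sub>1\<close> and q =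
  \<open>\<alpha> * K\<^sub>2\<close> are the first two entries of the maximum. For v there are two
  competing bounds, one by a and one by b, hence also all their convex combinations. The right
  combination makes the total bound a multiple of \<alpha> a + (1 - \<alpha>) b, and the factor is
  the third entry. If the weight this requires lies outside [0, 1], one of the two bounds alone
  gives the factor p or q. This is the real inequality \<open>interpolated_bound\<close>.\<close>

section \<open>Integration against a mixture of two measures\<close>

lemma space_mixture [simp]: "space (mixture \<alpha> \<mu> \<nu>) = space \<mu>"
  by (simp add: mixture_def space_measure_of_conv)

lemma sets_mixture [simp, measurable_cong]: "sets (mixture \<alpha> \<mu> \<nu>) = sets \<mu>"
  by (simp add: mixture_def)

text \<open>\<open>measure_of\<close> returns the prescribed set function only once that function is
  known to be a measure; countable additivity is inherited from the two components.\<close>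

lemma emeasure_mixture:
  assumes sets: "sets \<nu> = sets \<mu>" and A: "A \<in> sets \<mu>"
  shows "emeasure (mixture \<alpha> \<mu> \<nu>) A = ennreal \<alpha> * emeasure \<mu> A + ennreal (1 - \<alpha>) * emeasure \<nu> A"
  unfolding mixture_def
proof (rule emeasure_measure_of_sigma[OF sets.sigma_algebra_axioms _ _ A])
  show "positive (sets \<mu>) (\<lambda>A. ennreal \<alpha> * emeasure \<mu> A + ennreal (1 - \<alpha>) * emeasure \<nu> A)"
    by (simp add: positive_def)
  show "countably_additive (sets \<mu>) (\<lambda>A. ennreal \<alpha> * emeasure \<mu> A + ennreal (1 - \<alpha>) * emeasure \<nu> A)"
  proof (rule countably_additiveI)
    fix F :: "nat \<Rightarrow> _" assume F: "range F \<subseteq> sets \<mu>" "disjoint_family F"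
    have "(\<Sum>i. ennreal \<alpha> * emeasure \<mu> (F i) + ennreal (1 - \<alpha>) * emeasure \<nu> (F i)) =
      ennreal \<alpha> * (\<Sum>i. emeasure \<mu> (F i)) + ennreal (1 - \<alpha>) * (\<Sum>i. emeasure \<nu> (F i))"
      by (simp add: suminf_add[symmetric] ennreal_suminf_cmult)
    then show "(\<Sum>i. ennreal \<alpha> * emeasure \<mu> (F i) + ennreal (1 - \<alpha>) * emeasure \<nu> (F i)) =
      ennreal \<alpha> * emeasure \<mu> (\<Union>i. F i) + ennreal (1 - \<alpha>) * emeasure \<nu> (\<Union>i. F i)"
      using F sets by (simp add: suminf_emeasure)
  qed
qed

lemma mixture_0:
  assumes "sets \<nu> = sets \<mu>"
  shows "mixture 0 \<mu> \<nu> = \<nu>"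
  by (rule measure_eqI) (simp_all add: assms emeasure_mixture)

lemma mixture_1:
  assumes "sets \<nu> = sets \<mu>"
  shows "mixture 1 \<mu> \<nu> = \<mu>"
  by (rule measure_eqI) (simp_all add: assms emeasure_mixture)

text \<open>Both sides agree on indicators, are linear and respect increasing limits, so induction
  over measurable functions applies.\<close>

lemma nn_integral_mixture:
  assumes sets: "sets \<nu> = sets \<mu>" and "f \<in> borel_measurable \<mu>"
  shows "(\<integral>\<^sup>+x. f x \<partial>mixture \<alpha> \<mu> \<nu>) =
    ennreal \<alpha> * (\<integral>\<^sup>+x. f x \<partial>\<mu>) + ennreal (1 - \<alpha>) * (\<integral>\<^sup>+x. f x \<partial>\<nu>)"
  using assms(2)
proof induction
  case (cong f g)
  moreover have "space \<nu> = space \<mu>"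
    using sets by (rule sets_eq_imp_space_eq)
  ultimately show ?case
    by (simp cong: nn_integral_cong_simp)
next
  case (set A)
  then show ?case
    using sets by (simp add: emeasure_mixture)
next
  case (mult u c)
  then have "u \<in> borel_measurable \<nu>" "u \<in> borel_measurable (mixture \<alpha> \<mu> \<nu>)"
    using sets by (simp_all cong: measurable_cong_sets)
  with mult show ?case
    by (simp add: nn_integral_cmult algebra_simps)
next
  case (add u v)
  then have "u \<in> borel_measurable \<nu>" "u \<in> borel_measurable (mixture \<alpha> \<mu> \<nu>)"
    "v \<in> borel_measurable \<nu>" "v \<in> borel_measurable (mixture \<alpha> \<mu> \<nu>)"
    using sets by (simp_all cong: measurable_cong_sets)
  with add show ?case
    by (simp add: nn_integral_add algebra_simps)
next
  case (seq U)
  then have [measurable]: "U i \<in> borel_measurable \<nu>" "U i \<in> borel_measurable (mixture \<alpha> \<mu> \<nu>)" for i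
    using sets by (simp_all cong: measurable_cong_sets)
  \<comment> \<open>Monotonicity is what allows the supremum of the sums to be split into the sum of
    the suprema.\<close>
  have inc: "incseq (\<lambda>i. integral\<^sup>N \<rho> (U i))" for \<rho>
    using \<open>incseq U\<close> by (auto simp: incseq_def le_fun_def intro!: nn_integral_mono)
  have mono: "incseq (\<lambda>i. c * integral\<^sup>N \<rho> (U i))" for c \<rho>
    using inc[of \<rho>] by (auto simp: incseq_def intro!: mult_left_mono)
  have lim: "integral\<^sup>N \<rho> (Sup (range U)) = (SUP i. integral\<^sup>N \<rho> (U i))"
    if "\<And>i. U i \<in> borel_measurable \<rho>" for \<rho>
    using nn_integral_monotone_convergence_SUP[OF \<open>incseq U\<close> that] by (simp add: SUP_apply[abs_def] image_image)
  have "integral\<^sup>N (mixture \<alpha> \<mu> \<nu>) (Sup (range U)) =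
      (SUP i. ennreal \<alpha> * integral\<^sup>N \<mu> (U i) + ennreal (1 - \<alpha>) * integral\<^sup>N \<nu> (U i))"
    using seq.IH by (simp add: lim)
  also have "\<dots> = ennreal \<alpha> * integral\<^sup>N \<mu> (Sup (range U)) + ennreal (1 - \<alpha>) * integral\<^sup>N \<nu> (Sup (range U))"
    using seq.hyps by (simp add: lim SUP_mult_left_ennreal ennreal_SUP_add[OF mono mono])
  finally show ?case
    using \<open>f = Sup (range U)\<close> by (simp only:)
qed

lemma integral_mixture:
  fixes f :: "'a \<Rightarrow> real"
  assumes sets: "sets \<nu> = sets \<mu>" and \<alpha>: "0 \<le> \<alpha>" "\<alpha> \<le> 1"
    and f: "integrable \<mu> f" "integrable \<nu> f"
  shows "(\<integral>x. f x \<partial>mixture \<alpha> \<mu> \<nu>) = \<alpha> * (\<integral>x. f x \<partial>\<mu>) + (1 - \<alpha>) * (\<integral>x. f x \<partial>\<nu>)"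
proof -
  have meas: "f \<in> borel_measurable \<mu>"
    using f by simp
  \<comment> \<open>Since \<open>ennreal\<close> cuts off negative values, this formula for f and
    for -f covers the positive and the negative part; integrability makes both finite, so the
    identity can be carried back to the reals.\<close>
  have nn: "(\<integral>\<^sup>+x. ennreal (g x) \<partial>mixture \<alpha> \<mu> \<nu>) =
      ennreal (\<alpha> * enn2real (\<integral>\<^sup>+x. ennreal (g x) \<partial>\<mu>) + (1 - \<alpha>) * enn2real (\<integral>\<^sup>+x. ennreal (g x) \<partial>\<nu>))"
    if g: "integrable \<mu> g" "integrable \<nu> g" for g :: "'a \<Rightarrow> real"
  proof -
    obtain r s where "0 \<le> r" "0 \<le> s"
      "(\<integral>\<^sup>+x. ennreal (g x) \<partial>\<mu>) = ennreal r" "(\<integral>\<^sup>+x. ennreal (g x) \<partial>\<nu>) = ennreal s"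
      using g by (cases "\<integral>\<^sup>+x. ennreal (g x) \<partial>\<mu>"; cases "\<integral>\<^sup>+x. ennreal (g x) \<partial>\<nu>")
        (auto simp: real_integrable_def)
    with g \<alpha> show ?thesis
      by (simp add: nn_integral_mixture[OF sets] ennreal_mult)
  qed
  have "integrable (mixture \<alpha> \<mu> \<nu>) f"
    using f meas by (simp add: real_integrable_def nn cong: measurable_cong_sets)
  moreover have "enn2real (\<integral>\<^sup>+x. ennreal (g x) \<partial>mixture \<alpha> \<mu> \<nu>) =
      \<alpha> * enn2real (\<integral>\<^sup>+x. ennreal (g x) \<partial>\<mu>) + (1 - \<alpha>) * enn2real (\<integral>\<^sup>+x. ennreal (g x) \<partial>\<nu>)"
    if "integrable \<mu> g" "integrable \<nu> g" for g :: "'a \<Rightarrow> real"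
    using \<alpha> by (simp add: nn[OF that] del: ennreal_plus)
  ultimately show ?thesis
    using f by (simp add: real_lebesgue_integral_def) (simp add: algebra_simps)
qed

section \<open>Total variance and an interpolation inequality for real numbers\<close>

text \<open>Second moments mix linearly, squared means do not; since \<alpha> - \<alpha>^2 =
  \<alpha> (1 - \<alpha>), the discrepancy is the squared difference of the means with this
  weight.\<close>

lemma Var_mixture:
  assumes "sets \<nu> = sets \<mu>" "0 \<le> \<alpha>" "\<alpha> \<le> 1"
    and "integrable \<mu> f" "integrable \<nu> f"
    and "integrable \<mu> (\<lambda>x. (f x)\<^sup>2)" "integrable \<nu> (\<lambda>x. (f x)\<^sup>2)"
  shows "Var (mixture \<alpha> \<mu> \<nu>) f =
    \<alpha> * Var \<mu> f + (1 - \<alpha>) * Var \<nu> f + \<alpha> * (1 - \<alpha>) * ((\<integral>x. f x \<partial>\<mu>) - (\<integral>x. f x \<partial>\<nu>))\<^sup>2"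
  using assms by (simp add: Var_def integral_mixture power2_eq_square algebra_simps)

text \<open>On a probability space square integrability implies integrability, so \<open>Var\<close>
  is the integral of a squared deviation. \<open>interpolated_bound\<close> uses the sign to infer
  that a nonzero v is positive.\<close>

lemma (in prob_space) Var_nonneg:
  assumes "f \<in> L2 M"
  shows "0 \<le> Var M f"
proof -
  have "integrable M f"
    using assms by (auto simp: L2_def intro: square_integrable_imp_integrable)
  then have "Var M f = variance f"
    using assms by (simp add: Var_def L2_def variance_eq)
  then show ?thesis
    using variance_positive[of f] by simp
qed

text \<open>The two bounds \<open>c * b\<close> and \<open>k * a\<close> for \<open>v\<close> are averaged with the weight that makes the
  resulting coefficients of \<open>a\<close> and \<open>b\<close> proportional to \<open>\<alpha>\<close> and \<open>1 - \<alpha>\<close>; when that weight falls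
  outside \<open>[0, 1]\<close>, one of the two bounds alone suffices.\<close>

lemma interpolated_bound:
  fixes \<alpha> a b c k p q v :: real
  assumes \<alpha>: "0 < \<alpha>" "\<alpha> < 1" and ab: "0 \<le> a" "0 \<le> b" and v: "0 \<le> v" "v \<le> c * b" "v \<le> k * a"
  shows "\<alpha> * p * a + (1 - \<alpha>) * v + (1 - \<alpha>) * q * b
    \<le> Max {p, q, ((1 - \<alpha>) * k * c + \<alpha> * p * c + (1 - \<alpha>) * k * q) / ((1 - \<alpha>) * k + \<alpha> * c)}
        * (\<alpha> * a + (1 - \<alpha>) * b)"
    (is "_ \<le> ?M * _")
proof -
  define d where "d = (1 - \<alpha>) * k + \<alpha> * c"
  define r where "r = ((1 - \<alpha>) * k * c + \<alpha> * p * c + (1 - \<alpha>) * k * q) / d"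
  have M: "p \<le> ?M" "q \<le> ?M" "r \<le> ?M"
    by (auto simp: r_def d_def)
  have "p * (\<alpha> * a) \<le> ?M * (\<alpha> * a)" "q * ((1 - \<alpha>) * b) \<le> ?M * ((1 - \<alpha>) * b)"
    using \<alpha> ab M by (auto intro!: mult_right_mono)
  then have pq: "\<alpha> * p * a + (1 - \<alpha>) * q * b \<le> ?M * (\<alpha> * a + (1 - \<alpha>) * b)"
    by (simp add: algebra_simps)
  show ?thesis
  \<comment> \<open>No signs are assumed for c and k, so the denominator d could vanish or be
    negative. A nonzero v rules this out, because both of its upper bounds are then positive; for v
    = 0 the entries p and q suffice.\<close>
  proof (cases "v = 0")
    case True
    with pq show ?thesis by simp
  next
    case False
    with v have "0 < c * b" "0 < k * a"
      by linarith+
    then have pos: "0 < a" "0 < b" "0 < k" "0 < c"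
      using ab by (simp_all add: zero_less_mult_iff)
    have d: "0 < d"
      using \<alpha> pos by (simp add: d_def add_pos_pos)
    \<comment> \<open>Bounding v by t k a + (1 - t) c b leaves a linear form in a and b. The two
      conditions compare its coefficients with those of \<open>?M\<close> times \<alpha> a + (1 -
      \<alpha>) b, the second after division by 1 - \<alpha>.\<close>
    have weighted: ?thesis
      if t: "0 \<le> t" "t \<le> 1" and "\<alpha> * p + (1 - \<alpha>) * t * k \<le> \<alpha> * ?M" "q + (1 - t) * c \<le> ?M" for t
    proof -
      have "v = t * v + (1 - t) * v"
        by (simp add: algebra_simps)
      also have "\<dots> \<le> t * (k * a) + (1 - t) * (c * b)"
        using t v by (intro add_mono mult_left_mono) auto
      finally have "(1 - \<alpha>) * v \<le> (1 - \<alpha>) * (t * (k * a) + (1 - t) * (c * b))"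
        using \<alpha> by (intro mult_left_mono) auto
      moreover have "(\<alpha> * p + (1 - \<alpha>) * t * k) * a \<le> \<alpha> * ?M * a"
        using that ab by (intro mult_right_mono) auto
      moreover have "(q + (1 - t) * c) * ((1 - \<alpha>) * b) \<le> ?M * ((1 - \<alpha>) * b)"
        using that ab \<alpha> by (intro mult_right_mono) auto
      ultimately show ?thesis
        by (simp add: algebra_simps)
    qed
    \<comment> \<open>The solution of \<alpha> p + (1 - \<alpha>) t k = \<alpha> (q + (1 - t) c),
      which makes both conditions ask for the same lower bound on \<open>?M\<close>.\<close>
    define t where "t = \<alpha> * (q + c - p) / d"
    have "0 \<le> t \<longleftrightarrow> p \<le> q + c" "t \<le> 1 \<longleftrightarrow> \<alpha> * (q + c - p) \<le> d"
      using \<alpha> d by (auto simp: t_def zero_le_divide_iff zero_le_mult_iff)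
    \<comment> \<open>The first two alternatives mean t \<le> 0 and t \<ge> 1; there the weight is
      replaced by 0 and by 1, and the entries p and q suffice.\<close>
    then consider "q + c \<le> p" | "\<alpha> * p + (1 - \<alpha>) * k \<le> \<alpha> * q" | "0 \<le> t" "t \<le> 1"
      unfolding d_def by (simp add: algebra_simps) linarith
    then show ?thesis
    proof cases
      case 1
      then show ?thesis
        using weighted[of 0] M \<alpha> by simp
    next
      case 2
      moreover have "\<alpha> * q \<le> \<alpha> * ?M"
        using M \<alpha> by (intro mult_left_mono) auto
      ultimately show ?thesis
        using weighted[of 1] M by simp
    next
      case 3
      \<comment> \<open>Multiplying by d shows that this weight turns both conditions into r \<le>
        \<open>?M\<close>, up to the factor \<alpha>.\<close>
      have td: "t * d = \<alpha> * (q + c - p)" and rd: "r * d = (1 - \<alpha>) * k * c + \<alpha> * p * c + (1 - \<alpha>) * k * q"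
        using d by (simp_all add: t_def r_def)
      have "(\<alpha> * p + (1 - \<alpha>) * t * k) * d = \<alpha> * p * d + (1 - \<alpha>) * k * (t * d)"
        by (simp add: algebra_simps)
      also have "\<dots> = \<alpha> * r * d"
        unfolding td mult.assoc[of \<alpha> r] rd by (simp add: d_def algebra_simps)
      finally have 1: "\<alpha> * p + (1 - \<alpha>) * t * k = \<alpha> * r"
        using d by simp
      have "(q + (1 - t) * c) * d = (q + c) * d - c * (t * d)"
        by (simp add: algebra_simps)
      also have "\<dots> = r * d"
        unfolding td rd by (simp add: d_def algebra_simps)
      finally have 2: "q + (1 - t) * c = r"
        using d by simp
      show ?thesis
        using weighted[OF 3] 1 2 M mult_left_mono[OF M(3), of \<alpha>] \<alpha> by simp
    qed
  qed
qed

section \<open>The bound on the Poincare constant\<close>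

theorem proposition3p1:
  fixes \<A> :: "('m::{t2_space, second_countable_topology}, 'n::finite) chart set"
    and G :: "('m, 'n) chart \<Rightarrow> 'm \<Rightarrow> real ^ 'n ^ 'n"
    and vol :: "'m measure"
    and \<Omega> \<Sigma> :: "'m set"
    and \<mu>\<^sub>\<Omega> \<mu>\<^sub>\<Sigma> :: "'m measure"
    and D D\<tau> :: "('m \<Rightarrow> real) \<Rightarrow> ('m, 'n) vector_field"
    and D\<^sub>0 :: "('m \<Rightarrow> real) set"
    and C\<^sub>\<Omega> C\<^sub>\<Sigma> K\<^sub>\<Sigma>\<^sub>\<Omega> K\<^sub>1 K\<^sub>2 :: real
  defines "\<E> \<equiv> energy \<A> G \<Omega> \<mu>\<^sub>\<Omega> D \<Sigma> \<mu>\<^sub>\<Sigma> D\<tau>"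
    and "I\<^sub>\<Omega> \<equiv> \<lambda>f. dirichlet_integral \<A> G \<Omega> \<mu>\<^sub>\<Omega> D f f"
    and "I\<^sub>\<Sigma> \<equiv> \<lambda>f. dirichlet_integral \<A> G \<Sigma> \<mu>\<^sub>\<Sigma> D\<tau> f f"
  assumes "riemannian_manifold \<A> G"
    and "riemannian_volume \<A> G vol"
    and "open \<Omega>" and "connected \<Omega>" and "\<Omega> \<noteq> {}"
    and "piecewise_smooth \<A> (frontier \<Omega>)"
    and "\<Sigma> \<subseteq> frontier \<Omega>" and "compact \<Sigma>" and "connected \<Sigma>"
    and "smooth_hypersurface \<A> \<Sigma>"
    and "borel_prob_on (closure \<Omega>) \<mu>\<^sub>\<Omega>" and "measure_support \<mu>\<^sub>\<Omega> = closure \<Omega>"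
    and "\<forall>B\<in>sets \<mu>\<^sub>\<Omega>. emeasure vol (B \<inter> \<Omega>) = 0 \<longrightarrow> emeasure \<mu>\<^sub>\<Omega> B = 0"
    and "borel_prob_on (closure \<Omega>) \<mu>\<^sub>\<Sigma>" and "measure_support \<mu>\<^sub>\<Sigma> = \<Sigma>"
    and "\<forall>B\<in>sets \<mu>\<^sub>\<Sigma>. hausdorff_measure \<A> G (CARD('n) - 1) (B \<inter> \<Sigma>) = 0 \<longrightarrow> emeasure \<mu>\<^sub>\<Sigma> B = 0"
    and "gradient_operator_domain \<A> \<Omega> D"
    and "gradient_operator_boundary \<A> \<Omega> D\<tau>"
    and "D\<^sub>0 \<subseteq> C1 \<A> (closure \<Omega>)" and "dense_in_C (closure \<Omega>) D\<^sub>0"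
    and "finite_energy \<A> G \<Omega> \<mu>\<^sub>\<Omega> D D\<^sub>0" and "finite_energy \<A> G \<Sigma> \<mu>\<^sub>\<Sigma> D\<tau> D\<^sub>0"
    and "\<forall>\<alpha>\<in>{0..1}. pre_dirichlet_form (mixture \<alpha> \<mu>\<^sub>\<Omega> \<mu>\<^sub>\<Sigma>) D\<^sub>0 (\<E> \<alpha>)"
    and "\<forall>f\<in>D\<^sub>0. Var \<mu>\<^sub>\<Omega> f \<le> C\<^sub>\<Omega> * I\<^sub>\<Omega> f"
    and "\<forall>f\<in>D\<^sub>0. Var \<mu>\<^sub>\<Sigma> f \<le> C\<^sub>\<Sigma> * I\<^sub>\<Sigma> f"
    and "\<forall>f\<in>D\<^sub>0. Var \<mu>\<^sub>\<Sigma> f \<le> K\<^sub>\<Sigma>\<^sub>\<Omega> * I\<^sub>\<Omega> f"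
    and "\<forall>f\<in>D\<^sub>0. ((\<integral>p. f p \<partial>\<mu>\<^sub>\<Omega>) - (\<integral>p. f p \<partial>\<mu>\<^sub>\<Sigma>))\<^sup>2 \<le> K\<^sub>1 * I\<^sub>\<Omega> f + K\<^sub>2 * I\<^sub>\<Sigma> f"
  shows "\<forall>\<alpha>\<in>{0<..<1}. poincare_constant (mixture \<alpha> \<mu>\<^sub>\<Omega> \<mu>\<^sub>\<Sigma>) D\<^sub>0 (\<E> \<alpha>)
    \<le> ereal (Max {C\<^sub>\<Omega> + (1 - \<alpha>) * K\<^sub>1,
                  \<alpha> * K\<^sub>2,
                  ((1 - \<alpha>) * K\<^sub>\<Sigma>\<^sub>\<Omega> * C\<^sub>\<Sigma> + \<alpha> * C\<^sub>\<Omega> * C\<^sub>\<Sigma>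
                     + \<alpha> * (1 - \<alpha>) * (K\<^sub>\<Sigma>\<^sub>\<Omega> * K\<^sub>2 + C\<^sub>\<Sigma> * K\<^sub>1))
                  / ((1 - \<alpha>) * K\<^sub>\<Sigma>\<^sub>\<Omega> + \<alpha> * C\<^sub>\<Sigma>)})"
proof
  fix \<alpha> :: real assume "\<alpha> \<in> {0<..<1}"
  then have \<alpha>: "0 < \<alpha>" "\<alpha> < 1" by auto
  note prob = \<open>borel_prob_on (closure \<Omega>) \<mu>\<^sub>\<Omega>\<close> \<open>borel_prob_on (closure \<Omega>) \<mu>\<^sub>\<Sigma>\<close>
  interpret \<Omega>: prob_space \<mu>\<^sub>\<Omega>
    using prob by (auto simp: borel_prob_on_def intro: prob_spaceI)
  interpret \<Sigma>: prob_space \<mu>\<^sub>\<Sigma>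
    using prob by (auto simp: borel_prob_on_def intro: prob_spaceI)
  have sets: "sets \<mu>\<^sub>\<Sigma> = sets \<mu>\<^sub>\<Omega>"
    using prob by (simp add: borel_prob_on_def)
  \<comment> \<open>The endpoints 0 and 1 matter: there the mixture is one of the two measures and
    the form is \<open>I\<^sub>\<Sigma>\<close> or \<open>I\<^sub>\<Omega>\<close>, which yields
    square integrability for each measure and nonnegativity of each energy separately.\<close>
  have form: "symmetric_form (mixture \<beta> \<mu>\<^sub>\<Omega> \<mu>\<^sub>\<Sigma>) D\<^sub>0 (\<E> \<beta>)" if "\<beta> \<in> {0..1}" for \<beta>
    using assms(26) that by (simp add: pre_dirichlet_form_def)
  have in_L2: "f \<in> L2 (mixture \<beta> \<mu>\<^sub>\<Omega> \<mu>\<^sub>\<Sigma>)" and nonneg: "0 \<le> \<E> \<beta> f f"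
    if "\<beta> \<in> {0..1}" "f \<in> D\<^sub>0" for \<beta> f
    using form[OF that(1)] that(2) unfolding symmetric_form_def by blast+
  have E: "\<E> \<beta> f f = \<beta> * I\<^sub>\<Omega> f + (1 - \<beta>) * I\<^sub>\<Sigma> f" for \<beta> f
    by (simp add: \<E>_def I\<^sub>\<Omega>_def I\<^sub>\<Sigma>_def energy_def)
  define M where "M = Max {C\<^sub>\<Omega> + (1 - \<alpha>) * K\<^sub>1, \<alpha> * K\<^sub>2,
    ((1 - \<alpha>) * K\<^sub>\<Sigma>\<^sub>\<Omega> * C\<^sub>\<Sigma> + \<alpha> * C\<^sub>\<Omega> * C\<^sub>\<Sigma> + \<alpha> * (1 - \<alpha>) * (K\<^sub>\<Sigma>\<^sub>\<Omega> * K\<^sub>2 + C\<^sub>\<Sigma> * K\<^sub>1))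
      / ((1 - \<alpha>) * K\<^sub>\<Sigma>\<^sub>\<Omega> + \<alpha> * C\<^sub>\<Sigma>)}"
  \<comment> \<open>Matches the third entry of \<open>interpolated_bound\<close>, taken at p =
    \<open>C\<^sub>\<Omega> + (1 - \<alpha>) * K\<^sub>1\<close> and q =
    \<open>\<alpha> * K\<^sub>2\<close>, with the third entry of the claim.\<close>
  have numerator: "(1 - \<alpha>) * K\<^sub>\<Sigma>\<^sub>\<Omega> * C\<^sub>\<Sigma> + \<alpha> * (C\<^sub>\<Omega> + (1 - \<alpha>) * K\<^sub>1) * C\<^sub>\<Sigma> + (1 - \<alpha>) * K\<^sub>\<Sigma>\<^sub>\<Omega> * (\<alpha> * K\<^sub>2)
    = (1 - \<alpha>) * K\<^sub>\<Sigma>\<^sub>\<Omega> * C\<^sub>\<Sigma> + \<alpha> * C\<^sub>\<Omega> * C\<^sub>\<Sigma> + \<alpha> * (1 - \<alpha>) * (K\<^sub>\<Sigma>\<^sub>\<Omega> * K\<^sub>2 + C\<^sub>\<Sigma> * K\<^sub>1)"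
    by (simp add: algebra_simps)
  have bound: "Var (mixture \<alpha> \<mu>\<^sub>\<Omega> \<mu>\<^sub>\<Sigma>) f \<le> M * \<E> \<alpha> f f" if f: "f \<in> D\<^sub>0" for f
  proof -
    have L2: "f \<in> L2 \<mu>\<^sub>\<Omega>" "f \<in> L2 \<mu>\<^sub>\<Sigma>"
      using in_L2[OF _ f, of 1] in_L2[OF _ f, of 0] by (simp_all add: mixture_0[OF sets] mixture_1[OF sets])
    have I: "0 \<le> I\<^sub>\<Omega> f" "0 \<le> I\<^sub>\<Sigma> f"
      using nonneg[OF _ f, of 1] nonneg[OF _ f, of 0] by (simp_all add: E)
    have int: "integrable \<mu>\<^sub>\<Omega> f" "integrable \<mu>\<^sub>\<Sigma> f"
      using L2 by (auto simp: L2_def intro: \<Omega>.square_integrable_imp_integrable \<Sigma>.square_integrable_imp_integrable)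
    have "Var (mixture \<alpha> \<mu>\<^sub>\<Omega> \<mu>\<^sub>\<Sigma>) f = \<alpha> * Var \<mu>\<^sub>\<Omega> f + (1 - \<alpha>) * Var \<mu>\<^sub>\<Sigma> f
        + \<alpha> * (1 - \<alpha>) * ((\<integral>p. f p \<partial>\<mu>\<^sub>\<Omega>) - (\<integral>p. f p \<partial>\<mu>\<^sub>\<Sigma>))\<^sup>2"
      using L2 int \<alpha> by (intro Var_mixture[OF sets]) (auto simp: L2_def)
    \<comment> \<open>The variance on \<open>\<Sigma>\<close> stays unestimated here, so that its
      two bounds can be weighed against each other afterwards.\<close>
    also have "\<dots> \<le> \<alpha> * (C\<^sub>\<Omega> * I\<^sub>\<Omega> f) + (1 - \<alpha>) * Var \<mu>\<^sub>\<Sigma> f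
        + \<alpha> * (1 - \<alpha>) * (K\<^sub>1 * I\<^sub>\<Omega> f + K\<^sub>2 * I\<^sub>\<Sigma> f)"
      using assms(27,30) f \<alpha> by (intro add_mono mult_left_mono) auto
    also have "\<dots> = \<alpha> * (C\<^sub>\<Omega> + (1 - \<alpha>) * K\<^sub>1) * I\<^sub>\<Omega> f + (1 - \<alpha>) * Var \<mu>\<^sub>\<Sigma> f
        + (1 - \<alpha>) * (\<alpha> * K\<^sub>2) * I\<^sub>\<Sigma> f"
      by (simp add: algebra_simps)
    also have "\<dots> \<le> M * (\<alpha> * I\<^sub>\<Omega> f + (1 - \<alpha>) * I\<^sub>\<Sigma> f)"
      using interpolated_bound[OF \<alpha> I \<Sigma>.Var_nonneg[OF L2(2)] bspec[OF assms(28) f] bspec[OF assms(29) f],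
          of "C\<^sub>\<Omega> + (1 - \<alpha>) * K\<^sub>1" "\<alpha> * K\<^sub>2"]
      unfolding numerator M_def .
    finally show ?thesis
      by (simp add: E)
  qed
  have "poincare_constant (mixture \<alpha> \<mu>\<^sub>\<Omega> \<mu>\<^sub>\<Sigma>) D\<^sub>0 (\<E> \<alpha>) \<le> ereal M"
    unfolding poincare_constant_def
    by (intro SUP_least) (auto simp: pos_divide_le_eq bound)
  then show "poincare_constant (mixture \<alpha> \<mu>\<^sub>\<Omega> \<mu>\<^sub>\<Sigma>) D\<^sub>0 (\<E> \<alpha>)
    \<le> ereal (Max {C\<^sub>\<Omega> + (1 - \<alpha>) * K\<^sub>1,
                  \<alpha> * K\<^sub>2,
                  ((1 - \<alpha>) * K\<^sub>\<Sigma>\<^sub>\<Omega> * C\<^sub>\<Sigma> + \<alpha> * C\<^sub>\<Omega> * C\<^sub>\<Sigma>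
                     + \<alpha> * (1 - \<alpha>) * (K\<^sub>\<Sigma>\<^sub>\<Omega> * K\<^sub>2 + C\<^sub>\<Sigma> * K\<^sub>1))
                  / ((1 - \<alpha>) * K\<^sub>\<Sigma>\<^sub>\<Omega> + \<alpha> * C\<^sub>\<Sigma>)})"
    by (simp only: M_def)
qed

end
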